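(* In the online setting, where the characters of a text $T$ over a constant-size alphabet $\Sigma$ arrive one at a time and, after reading the first $n$ characters, the implicit suffix tree of $T[1\ldots n]$ with suffix links, Weiner links and the Breslauer–Italiano implicit-node structure has been maintained, the \textsc{single-nf} problem can be solved in worst-case $\mathcal{O}(|S|)$ time: given any query string $S$, the net frequency of $S$ in $T[1\ldots n]$ can be reported in $\mathcal{O}(|S|)$ worst-case time.
   Context: $T[i\ldots j]$ denotes a substring; for the current text $T[1\ldots n]$, $f(P)$ is the number of occurrences of a string $P$. An occurrence $(i,j)$ is a net occurrence if $f(T[i\ldots j])\ge 2$, $f(T[i-1\ldots j])=1$ and $f(T[i\ldots j+1])=1$, where the second condition is considered true when $i=1$ and the third when $j=n$; the net frequency of $S$ is the number of net occurrences $(i,j)$ with $T[i\ldots j]=S$. The implicit suffix tree of $T[1\ldots n]$ is the compacted trie of all its suffixes (no sentinel), keeping explicit only the root, nodes with at least two children, and leaves. Suffix links point from a node with label $x P$ ($x\in\Sigma$) to the node with label $P$; Weiner links are their reverses. By Ukkonen's algorithm extended by Breslauer and Italiano, this tree together with suffix and Weiner links can be maintained in $\mathcal{O}(n)$ total amortized time, and a query returning the implicit nodes (loci whose strings are suffixes occurring at least twice) within a given edge takes worst-case $\mathcal{O}(1)$ time. *)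

theory Defs
  imports Complex_Main "HOL-Library.Sublist"
begin

section \<open>Occurrences and net frequency\<close>

text \<open>Positions are 1-based and \<open>substr T i j\<close> is \<open>T[i..j]\<close>, with both ends included. The empty string
  is admitted throughout, with occurrences \<open>(i, i - 1)\<close>; these are written with \<open>j = i - 1\<close> and
  therefore satisfy \<open>i \<le> Suc j\<close>.\<close>

definition substr :: "'a list \<Rightarrow> nat \<Rightarrow> nat \<Rightarrow> 'a list" where
  "substr T i j = take (Suc j - i) (drop (i - 1) T)"

definition occurrences :: "'a list \<Rightarrow> 'a list \<Rightarrow> (nat \<times> nat) set" where
  "occurrences T P =
     {(i, j). 1 \<le> i \<and> i \<le> Suc j \<and> j \<le> length T \<and> substr T i j = P}"

definition freq :: "'a list \<Rightarrow> 'a list \<Rightarrow> nat" where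
  "freq T P = card (occurrences T P)"

definition net_occurrence :: "'a list \<Rightarrow> nat \<Rightarrow> nat \<Rightarrow> bool" where
  "net_occurrence T i j \<longleftrightarrow>
     freq T (substr T i j) \<ge> 2 \<and>
     (i = 1 \<or> freq T (substr T (i - 1) j) = 1) \<and>
     (j = length T \<or> freq T (substr T i (j + 1)) = 1)"

definition net_freq :: "'a list \<Rightarrow> 'a list \<Rightarrow> nat" where
  "net_freq T S = card {(i, j) \<in> occurrences T S. net_occurrence T i j}"


section \<open>The implicit suffix tree\<close>

text \<open>A locus of the trie is identified with the string that labels the path from the root to it.\<close>

definition suffix_trie :: "'a list \<Rightarrow> 'a list set" where
  "suffix_trie T = {P. \<exists>U. suffix U T \<and> prefix P U}"

definition trie_children :: "'a list \<Rightarrow> 'a list \<Rightarrow> 'a set" where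
  "trie_children T P = {c. P @ [c] \<in> suffix_trie T}"

definition trie_leaf :: "'a list \<Rightarrow> 'a list \<Rightarrow> bool" where
  "trie_leaf T P \<longleftrightarrow> P \<in> suffix_trie T \<and> trie_children T P = {}"

definition explicit_nodes :: "'a list \<Rightarrow> 'a list set" where
  "explicit_nodes T =
     {P \<in> suffix_trie T. P = [] \<or> card (trie_children T P) \<ge> 2 \<or> trie_leaf T P}"

definition tree_edge :: "'a list \<Rightarrow> 'a list \<Rightarrow> 'a list \<Rightarrow> bool" where
  "tree_edge T P Q \<longleftrightarrow>
     P \<in> explicit_nodes T \<and> Q \<in> explicit_nodes T \<and> strict_prefix P Q \<and>
     \<not> (\<exists>R \<in> explicit_nodes T. strict_prefix P R \<and> strict_prefix R Q)"

text \<open>An implicit node strictly inside the edge from \<open>P\<close> to \<open>Q\<close> is given by its distance from \<open>P\<close>.\<close>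

definition implicit_nodes :: "'a list \<Rightarrow> 'a list \<Rightarrow> 'a list \<Rightarrow> nat set" where
  "implicit_nodes T P Q =
     {k. 0 < k \<and> length P + k < length Q \<and>
         (let R = take (length P + k) Q in suffix R T \<and> freq T R \<ge> 2)}"

text \<open>A stored tree. Characters and node identifiers are natural numbers, 0 is the null pointer, and
  an edge is referred to by its lower node. An edge stores the first and last position of some
  occurrence of its label in the text. The answer to an implicit-node query on an edge is a
  sequence, accessible through its length and by index, in ascending order. (The distances on one edge form an
  arithmetic progression, so a constant-size answer gives constant-time access to each of them.)
  Occurrence counts of strings are not stored.\<close>

record suffix_tree =
  text_len :: nat
  text_char :: "nat \<Rightarrow> nat"
  root :: nat
  is_leaf :: "nat \<Rightarrow> bool"
  child :: "nat \<Rightarrow> nat \<Rightarrow> nat"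
  edge_first :: "nat \<Rightarrow> nat"
  edge_last :: "nat \<Rightarrow> nat"
  suffix_link :: "nat \<Rightarrow> nat"
  weiner_link :: "nat \<Rightarrow> nat \<Rightarrow> nat"
  implicit_count :: "nat \<Rightarrow> nat"
  implicit_node :: "nat \<Rightarrow> nat \<Rightarrow> nat"

text \<open>\<open>N\<close> is the set of node identifiers and \<open>lab\<close> maps a node to its path label; neither is part of
  the stored tree. The fields are unconstrained outside \<open>N\<close> and outside the text.\<close>

definition represents_via :: "nat set \<Rightarrow> (nat \<Rightarrow> nat list) \<Rightarrow> suffix_tree \<Rightarrow> nat list \<Rightarrow> bool" where
  "represents_via N lab D T \<longleftrightarrow>
     text_len D = length T \<and>
     (\<forall>i \<in> {1..length T}. text_char D i = T ! (i - 1)) \<and>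
     0 \<notin> N \<and> bij_betw lab N (explicit_nodes T) \<and>
     root D \<in> N \<and> lab (root D) = [] \<and>
     (\<forall>v \<in> N. is_leaf D v \<longleftrightarrow> trie_leaf T (lab v)) \<and>
     (\<forall>v \<in> N. \<forall>c w. child D v c = w \<and> w \<noteq> 0 \<longleftrightarrow>
        w \<in> N \<and> tree_edge T (lab v) (lab w) \<and> prefix (lab v @ [c]) (lab w)) \<and>
     (\<forall>v \<in> N. \<forall>w. suffix_link D v = w \<and> w \<noteq> 0 \<longleftrightarrow>
        w \<in> N \<and> (\<exists>x. lab v = x # lab w)) \<and>
     (\<forall>w \<in> N. \<forall>x v. weiner_link D w x = v \<and> v \<noteq> 0 \<longleftrightarrow>
        v \<in> N \<and> lab v = x # lab w) \<and>
     (\<forall>v \<in> N. \<forall>P. tree_edge T P (lab v) \<longrightarrow>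
        1 \<le> edge_first D v \<and> edge_first D v \<le> edge_last D v \<and> edge_last D v \<le> length T \<and>
        lab v = P @ substr T (edge_first D v) (edge_last D v) \<and>
        (let I = implicit_nodes T P (lab v) in
           implicit_count D v = card I \<and>
           (\<forall>m < card I. implicit_node D v m = sorted_list_of_set I ! m)))"

definition represents :: "suffix_tree \<Rightarrow> nat list \<Rightarrow> bool" where
  "represents D T \<longleftrightarrow> (\<exists>N lab. represents_via N lab D T)"


section \<open>Query programs and their running time\<close>

text \<open>A query program is a fixed while-program over finitely many registers. It has read-only
  access to the stored tree (with the text) and to the query string. The only arithmetic is
  successor and truncated subtraction, so in \<open>t\<close> steps no register exceeds by more than \<open>t\<close> the
  largest number found in the program, the input and the stored tree: unit cost is not exploited
  through large numbers.\<close>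

datatype op0 = TextLen | QueryLen | Root

datatype op1 =
    Succ | TextChar | QueryChar | IsLeaf | EdgeFirst | EdgeLast | SuffixLink | ImplicitCount

datatype op2 = Minus | Child | WeinerLink | ImplicitNode

datatype exp =
    Lit nat
  | Reg nat
  | Op0 op0
  | Op1 op1 exp
  | Op2 op2 exp exp

datatype test =
    Less exp exp
  | Neg test
  | Conj test test

datatype prog =
    Skip
  | Assign nat exp
  | Seq prog prog
  | If test prog prog
  | While test prog

fun eval0 :: "suffix_tree \<Rightarrow> nat list \<Rightarrow> op0 \<Rightarrow> nat" where
  "eval0 D S TextLen = text_len D"
| "eval0 D S QueryLen = length S"
| "eval0 D S Root = root D"

fun eval1 :: "suffix_tree \<Rightarrow> nat list \<Rightarrow> op1 \<Rightarrow> nat \<Rightarrow> nat" where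
  "eval1 D S Succ n = Suc n"
| "eval1 D S TextChar i = text_char D i"
| "eval1 D S QueryChar i = (if 1 \<le> i \<and> i \<le> length S then S ! (i - 1) else 0)"
| "eval1 D S IsLeaf v = of_bool (is_leaf D v)"
| "eval1 D S EdgeFirst v = edge_first D v"
| "eval1 D S EdgeLast v = edge_last D v"
| "eval1 D S SuffixLink v = suffix_link D v"
| "eval1 D S ImplicitCount v = implicit_count D v"

fun eval2 :: "suffix_tree \<Rightarrow> op2 \<Rightarrow> nat \<Rightarrow> nat \<Rightarrow> nat" where
  "eval2 D Minus m n = m - n"
| "eval2 D Child v c = child D v c"
| "eval2 D WeinerLink v x = weiner_link D v x"
| "eval2 D ImplicitNode v m = implicit_node D v m"

fun eval :: "suffix_tree \<Rightarrow> nat list \<Rightarrow> (nat \<Rightarrow> nat) \<Rightarrow> exp \<Rightarrow> nat" where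
  "eval D S s (Lit n) = n"
| "eval D S s (Reg r) = s r"
| "eval D S s (Op0 f) = eval0 D S f"
| "eval D S s (Op1 f a) = eval1 D S f (eval D S s a)"
| "eval D S s (Op2 f a b) = eval2 D f (eval D S s a) (eval D S s b)"

fun holds :: "suffix_tree \<Rightarrow> nat list \<Rightarrow> (nat \<Rightarrow> nat) \<Rightarrow> test \<Rightarrow> bool" where
  "holds D S s (Less a b) \<longleftrightarrow> eval D S s a < eval D S s b"
| "holds D S s (Neg p) \<longleftrightarrow> \<not> holds D S s p"
| "holds D S s (Conj p q) \<longleftrightarrow> holds D S s p \<and> holds D S s q"

fun exp_cost :: "exp \<Rightarrow> nat" where
  "exp_cost (Op1 f a) = Suc (exp_cost a)"
| "exp_cost (Op2 f a b) = Suc (exp_cost a + exp_cost b)"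
| "exp_cost _ = 1"

fun test_cost :: "test \<Rightarrow> nat" where
  "test_cost (Less a b) = Suc (exp_cost a + exp_cost b)"
| "test_cost (Neg p) = Suc (test_cost p)"
| "test_cost (Conj p q) = Suc (test_cost p + test_cost q)"

text \<open>\<open>runs D S p s t s'\<close>: started in register state \<open>s\<close>, the program \<open>p\<close> halts in state \<open>s'\<close> after
  exactly \<open>t\<close> elementary steps.\<close>

inductive runs ::
  "suffix_tree \<Rightarrow> nat list \<Rightarrow> prog \<Rightarrow> (nat \<Rightarrow> nat) \<Rightarrow> nat \<Rightarrow> (nat \<Rightarrow> nat) \<Rightarrow> bool"
  for D S
where
  runs_Skip: "runs D S Skip s 1 s"
| runs_Assign: "runs D S (Assign r a) s (Suc (exp_cost a)) (s(r := eval D S s a))"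
| runs_Seq: "runs D S p s t s' \<Longrightarrow> runs D S q s' t' s'' \<Longrightarrow> runs D S (Seq p q) s (t + t') s''"
| runs_IfTrue: "holds D S s b \<Longrightarrow> runs D S p s t s' \<Longrightarrow>
    runs D S (If b p q) s (test_cost b + t) s'"
| runs_IfFalse: "\<not> holds D S s b \<Longrightarrow> runs D S q s t s' \<Longrightarrow>
    runs D S (If b p q) s (test_cost b + t) s'"
| runs_WhileFalse: "\<not> holds D S s b \<Longrightarrow> runs D S (While b p) s (test_cost b) s"
| runs_WhileTrue: "holds D S s b \<Longrightarrow> runs D S p s t s' \<Longrightarrow> runs D S (While b p) s' t' s'' \<Longrightarrow>
    runs D S (While b p) s (test_cost b + t + t') s''"

text \<open>All registers are initially 0 and the result is left in register 0.\<close>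

definition computes_within :: "prog \<Rightarrow> suffix_tree \<Rightarrow> nat list \<Rightarrow> nat \<Rightarrow> nat \<Rightarrow> bool" where
  "computes_within p D S result bound \<longleftrightarrow>
     (\<exists>t s. runs D S p (\<lambda>_. 0) t s \<and> s 0 = result \<and> t \<le> bound)"

end

theory Submission
  imports Defs
begin

text \<open>A string at a locus above a non-leaf node occurs at least twice. At a locus on an edge to a leaf,
  every occurrence but one runs into the end of the text inside that edge, so the string is unique
  iff its locus is deeper than all implicit nodes of the edge, that is, deeper than the last one in
  the stored sequence. Hence descending from the root along a string determines whether it occurs
  0, 1 or more times, in time linear in its length. If \<open>S\<close> is repeated, its net occurrences are
  identified by a neighbouring character: for each \<open>x\<close> with \<open>xS\<close> unique, the occurrence after \<open>x\<close> is
  net iff every \<open>y\<close> for which \<open>xSy\<close> occurs has \<open>Sy\<close> unique; and for each \<open>y\<close> with \<open>Sy\<close> unique, the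
  occurrence before \<open>y\<close> is net and starts the text iff no \<open>xSy\<close> occurs. As the alphabet is fixed,
  constantly many descents along \<open>xS\<close>, \<open>Sy\<close> and \<open>xSy\<close> suffice; suffix links and Weiner links are
  not followed.\<close>

section \<open>Occurrences and branching\<close>

text \<open>Zero-based start positions. The bound is for the empty pattern: \<open>drop i T\<close>
  is empty for every larger \<open>i\<close>, so \<open>[]\<close> would otherwise start infinitely
  often.\<close>

definition starts :: "'a list \<Rightarrow> 'a list \<Rightarrow> nat set" where
  "starts T P = {i. i \<le> length T \<and> prefix P (drop i T)}"

lemma finite_starts [simp]: "finite (starts T P)"
  by (rule finite_subset[of _ "{..length T}"]) (auto simp: starts_def)

lemma starts_length: "i \<in> starts T P \<Longrightarrow> i + length P \<le> length T"
  by (auto simp: starts_def dest!: prefix_length_le)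

lemma substr_start:
  "i \<in> starts T P \<Longrightarrow> substr T (Suc i) (i + length P) = P"
  by (auto simp: starts_def substr_def prefix_def)

text \<open>The length of \<open>P\<close> fixes the end of an occurrence, so pairs reduce to
  starts. For \<open>P = []\<close> the pair is \<open>(Suc i, i)\<close>, the convention for empty
  occurrences.\<close>

lemma occurrences_eq:
  "occurrences T P = (\<lambda>i. (Suc i, i + length P)) ` starts T P" (is "?L = ?R")
proof
  show "?L \<subseteq> ?R"
  proof
    fix p assume "p \<in> ?L"
    then obtain i j where p: "p = (i, j)" "1 \<le> i" "i \<le> Suc j" "j \<le> length T" "substr T i j = P"
      by (auto simp: occurrences_def)
    have len: "length P = Suc j - i" using p by (auto simp: substr_def)
    have "i - 1 \<in> starts T P"
      using p take_is_prefix by (auto simp: starts_def substr_def)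
    moreover have "p = (Suc (i - 1), (i - 1) + length P)" using p len by auto
    ultimately show "p \<in> ?R" by blast
  qed
  show "?R \<subseteq> ?L"
    using starts_length substr_start by (fastforce simp: occurrences_def)
qed

lemma freq_eq: "freq T P = card (starts T P)"
  unfolding freq_def occurrences_eq by (rule card_image) (auto simp: inj_on_def)

lemma starts_mono: "prefix P Q \<Longrightarrow> starts T Q \<subseteq> starts T P"
  using prefix_order.trans by (auto simp: starts_def)

lemma freq_antimono: "prefix P Q \<Longrightarrow> freq T Q \<le> freq T P"
  unfolding freq_eq by (rule card_mono) (auto dest: starts_mono)

lemma starts_Nil: "starts T [] = {..length T}"
  by (auto simp: starts_def)

lemma starts_Cons:
  "i \<in> starts T (x # P) \<longleftrightarrow> i < length T \<and> T ! i = x \<and> Suc i \<in> starts T P"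
  by (cases "i < length T") (auto simp: starts_def Cons_nth_drop_Suc[symmetric])

lemma starts_snoc:
  "i \<in> starts T (P @ [y]) \<longleftrightarrow>
     i + length P < length T \<and> T ! (i + length P) = y \<and> i \<in> starts T P"
  by (induction P arbitrary: i) (auto simp: starts_Cons starts_Nil)

section \<open>Loci, branching nodes, leaves and edges of the trie\<close>

lemma suffix_trie_iff: "P \<in> suffix_trie T \<longleftrightarrow> starts T P \<noteq> {}"
proof
  assume "P \<in> suffix_trie T"
  then obtain V U where "T = V @ U" "prefix P U" by (auto simp: suffix_trie_def suffix_def)
  then have "length V \<in> starts T P" by (auto simp: starts_def)
  then show "starts T P \<noteq> {}" by blast
next
  assume "starts T P \<noteq> {}"
  then show "P \<in> suffix_trie T"
    using suffix_drop by (fastforce simp: starts_def suffix_trie_def)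
qed

lemma suffix_trie_freq: "P \<in> suffix_trie T \<longleftrightarrow> freq T P > 0"
  by (simp add: suffix_trie_iff freq_eq card_gt_0_iff)

lemma suffix_trie_prefix: "Q \<in> suffix_trie T \<Longrightarrow> prefix P Q \<Longrightarrow> P \<in> suffix_trie T"
  using starts_mono by (fastforce simp: suffix_trie_iff)

lemma freq_ge_2_iff:
  "2 \<le> freq T P \<longleftrightarrow> (\<exists>i \<in> starts T P. \<exists>j \<in> starts T P. i \<noteq> j)"
proof -
  have "2 \<le> freq T P \<longleftrightarrow> \<not> card (starts T P) \<le> Suc 0" by (auto simp: freq_eq)
  then show ?thesis by (auto simp: card_le_Suc0_iff_eq)
qed

lemma freq_eq_1_iff: "freq T P = 1 \<longleftrightarrow> (\<exists>i. starts T P = {i})"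
  by (simp add: freq_eq card_1_singleton_iff)

text \<open>A start of \<open>P\<close> is followed by at most one character, so two continuations
  need two starts.\<close>

lemma freq_ge_2_branching:
  assumes "P @ [c] \<in> suffix_trie T" "P @ [c'] \<in> suffix_trie T" "c \<noteq> c'"
  shows "2 \<le> freq T P"
proof -
  obtain i j where "i \<in> starts T (P @ [c])" "j \<in> starts T (P @ [c'])"
    using assms(1,2) by (auto simp: suffix_trie_iff)
  then show ?thesis
    using assms(3) unfolding freq_ge_2_iff starts_snoc by (intro bexI[of _ i] bexI[of _ j]) auto
qed

lemma trie_children_finite [simp]: "finite (trie_children T P)"
proof (rule finite_subset)
  show "trie_children T P \<subseteq> set T"
    by (auto simp: trie_children_def suffix_trie_iff starts_snoc)
qed simp

lemma card_trie_children_ge_2_iff: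
  "2 \<le> card (trie_children T P) \<longleftrightarrow>
     (\<exists>c c'. c \<noteq> c' \<and> P @ [c] \<in> suffix_trie T \<and> P @ [c'] \<in> suffix_trie T)"
proof -
  have "2 \<le> card (trie_children T P) \<longleftrightarrow> \<not> card (trie_children T P) \<le> Suc 0" by auto
  then show ?thesis by (auto simp: card_le_Suc0_iff_eq) (auto simp: trie_children_def)
qed

text \<open>An occurrence ending before the text does would extend by the next character, giving the
  leaf a child.\<close>

lemma trie_leaf_starts:
  assumes "trie_leaf T L" "i \<in> starts T L"
  shows "i + length L = length T"
proof (rule ccontr)
  assume "i + length L \<noteq> length T"
  then have "i \<in> starts T (L @ [T ! (i + length L)])"
    using assms(2) starts_length[OF assms(2)] by (auto simp: starts_snoc)
  then show False
    using assms(1) by (auto simp: trie_leaf_def trie_children_def suffix_trie_iff)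
qed

lemma trie_leaf_freq:
  assumes "trie_leaf T L" shows "freq T L = 1"
proof -
  obtain i where i: "i \<in> starts T L" using assms by (auto simp: trie_leaf_def suffix_trie_iff)
  have "starts T L = {i}"
    using i trie_leaf_starts[OF assms i] trie_leaf_starts[OF assms]
    by auto (metis add_right_cancel)
  then show ?thesis by (simp add: freq_eq)
qed

text \<open>Appending available characters must stop, because no string of the trie is longer than
  the text.\<close>

lemma extend_to_leaf:
  assumes "Q \<in> suffix_trie T"
  shows "\<exists>L. trie_leaf T L \<and> prefix Q L"
  using assms
proof (induction "length T - length Q" arbitrary: Q rule: less_induct)
  case less
  show ?case
  proof (cases "trie_leaf T Q")
    case False
    then obtain c where c: "Q @ [c] \<in> suffix_trie T"
      using less.prems by (auto simp: trie_leaf_def trie_children_def)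
    then have "length T - length (Q @ [c]) < length T - length Q"
      using starts_length by (fastforce simp: suffix_trie_iff)
    then obtain L where "trie_leaf T L" "prefix (Q @ [c]) L" using less.hyps c by blast
    then show ?thesis using append_prefixD by blast
  qed auto
qed

lemma trie_leaf_explicit: "trie_leaf T L \<Longrightarrow> L \<in> explicit_nodes T"
  by (auto simp: explicit_nodes_def trie_leaf_def)

text \<open>The lower end is a shortest explicit node extending \<open>P @ [c]\<close>. Candidates
  exist because leaves are explicit, and an explicit node inside the edge would be a shorter
  candidate.\<close>

lemma tree_edge_exists:
  assumes P: "P \<in> explicit_nodes T" and c: "P @ [c] \<in> suffix_trie T"
  shows "\<exists>Q. tree_edge T P Q \<and> prefix (P @ [c]) Q"
proof -
  define W where "W = {Q \<in> explicit_nodes T. prefix (P @ [c]) Q}"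
  obtain L where "L \<in> W"
    using extend_to_leaf[OF c] trie_leaf_explicit by (auto simp: W_def)
  define Q where "Q = arg_min length (\<lambda>Q. Q \<in> W)"
  have Q: "Q \<in> W" "\<And>R. R \<in> W \<Longrightarrow> length Q \<le> length R"
    using arg_min_nat_lemma[of "\<lambda>Q. Q \<in> W", OF \<open>L \<in> W\<close>, of length] by (auto simp: Q_def)
  have False if R: "R \<in> explicit_nodes T" "strict_prefix P R" "strict_prefix R Q" for R
  proof -
    have "prefix (P @ [c]) R"
    proof (rule prefix_length_prefix)
      show "prefix (P @ [c]) Q" using Q(1) by (simp add: W_def)
      show "prefix R Q" using R(3) by (simp add: strict_prefix_def)
      show "length (P @ [c]) \<le> length R" using prefix_length_less[OF R(2)] by simp
    qed
    then have "R \<in> W" using R by (simp add: W_def)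
    then show False using Q(2) R(3) prefix_length_less by fastforce
  qed
  then show ?thesis
    using P Q(1) by (intro exI[of _ Q]) (auto simp: tree_edge_def W_def dest: prefix_snocD)
qed

text \<open>\<open>L\<close> itself supplies one continuation of \<open>M\<close>; a second would
  make \<open>M\<close> a branching, hence explicit, node strictly inside the edge.\<close>

lemma tree_edge_interior:
  assumes e: "tree_edge T P L" and M: "length P < length M" "strict_prefix M L"
  shows "M @ [c] \<in> suffix_trie T \<longleftrightarrow> c = L ! length M"
proof -
  have L: "L \<in> suffix_trie T" "prefix P L" and
    none: "\<And>R. R \<in> explicit_nodes T \<Longrightarrow> strict_prefix P R \<Longrightarrow> \<not> strict_prefix R L"
    using e by (auto simp: tree_edge_def explicit_nodes_def strict_prefix_def)
  have M_trie: "M \<in> suffix_trie T" using M L suffix_trie_prefix by (auto simp: strict_prefix_def)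
  have "strict_prefix P M"
    using M L prefix_length_prefix[of P L M] by (auto simp: strict_prefix_def)
  then have "M \<notin> explicit_nodes T" using none M by blast
  then have unique: "\<not> 2 \<le> card (trie_children T M)"
    using M_trie by (auto simp: explicit_nodes_def)
  obtain Z where Z: "L = M @ Z" "Z \<noteq> []" using M by (auto simp: strict_prefix_def prefix_def)
  then have U: "L = M @ L ! length M # tl Z" by (cases Z) auto
  have "M @ [L ! length M] \<in> suffix_trie T"
    by (rule suffix_trie_prefix[OF L(1)]) (metis U append.assoc append_Cons append_Nil prefixI)
  then show "M @ [c] \<in> suffix_trie T \<longleftrightarrow> c = L ! length M"
    using unique unfolding card_trie_children_ge_2_iff by blast
qed

text \<open>Apart from the root, such a node branches. The root label \<open>[]\<close> has
  \<open>length T + 1\<close> starts, which is why the text must be nonempty.\<close>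

lemma explicit_inner_freq:
  assumes "L \<in> explicit_nodes T" "\<not> trie_leaf T L" "T \<noteq> []"
  shows "2 \<le> freq T L"
proof (cases "L = []")
  case True
  then show ?thesis using assms(3) by (cases T) (auto simp: freq_eq starts_Nil)
next
  case False
  then have "2 \<le> card (trie_children T L)" using assms by (auto simp: explicit_nodes_def)
  then show ?thesis using card_trie_children_ge_2_iff freq_ge_2_branching by metis
qed

text \<open>A second occurrence of a string above a leaf cannot leave the edge, as it would create a
  branching node there; it therefore runs into the end of the text inside the edge.\<close>
lemma leaf_edge_freq:
  assumes e: "tree_edge T P L" and leaf: "trie_leaf T L"
    and d: "0 < d" "length P + d \<le> length L"
  shows "2 \<le> freq T (take (length P + d) L) \<longleftrightarrow> (\<exists>k \<in> implicit_nodes T P L. d \<le> k)"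
proof
  let ?Q = "take (length P + d) L"
  assume "\<exists>k \<in> implicit_nodes T P L. d \<le> k"
  then obtain k where k: "d \<le> k" "2 \<le> freq T (take (length P + k) L)"
    by (auto simp: implicit_nodes_def Let_def)
  have "prefix ?Q (take (length P + k) L)" using k(1)
    by (metis add_le_cancel_left min.absorb1 take_is_prefix take_take)
  then show "2 \<le> freq T ?Q" using k(2) freq_antimono le_trans by blast
next
  let ?Q = "take (length P + d) L"
  assume "2 \<le> freq T ?Q"
  moreover have "\<exists>i. starts T L = {i}" using trie_leaf_freq[OF leaf] freq_eq_1_iff by metis
  then obtain i where i: "starts T L = {i}" by blast
  ultimately obtain i' where i': "i' \<in> starts T ?Q" "i' \<noteq> i" by (auto simp: freq_ge_2_iff)
  \<comment> \<open>\<open>R\<close> is the whole suffix beginning at the second occurrence. It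
    turns out to end strictly inside the edge, at distance at least \<open>d\<close>, which makes it
    the implicit node sought.\<close>
  define R where "R = drop i' T"
  have QR: "prefix ?Q R" using i' by (auto simp: starts_def R_def)
  have LR: "\<not> prefix L R" using i i' by (auto simp: starts_def R_def)
  have RT: "R \<in> suffix_trie T" and "suffix R T"
    using suffix_drop by (auto simp: suffix_trie_def R_def)
  \<comment> \<open>Otherwise \<open>R\<close> and \<open>L\<close> split after a common part
    \<open>M\<close>. As \<open>?Q\<close> is a prefix of both, \<open>M\<close> is at least as long
    as \<open>?Q\<close>, so the split happens inside the edge, where the continuation is
    unique.\<close>
  have "prefix R L"
  proof (rule ccontr)
    assume "\<not> prefix R L"
    with LR have "R \<parallel> L" by auto
    then obtain M c B c' C where M: "c \<noteq> c'" "R = M @ c # B" "L = M @ c' # C"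
      using parallel_decomp by metis
    have "length ?Q \<le> length M"
    proof (rule ccontr)
      assume "\<not> length ?Q \<le> length M"
      then have lt: "length M < length ?Q" by linarith
      have "?Q ! length M = R ! length M" using QR lt by (auto simp: prefix_def nth_append simp del: length_take)
      moreover have "?Q ! length M = L ! length M" using lt by simp
      ultimately have "c = c'" using M by simp
      then show False using M by simp
    qed
    then have "M @ [c] \<in> suffix_trie T \<longleftrightarrow> c = L ! length M"
      by (intro tree_edge_interior[OF e]) (use d M in \<open>auto simp: strict_prefix_def\<close>)
    moreover have "M @ [c] \<in> suffix_trie T"
      by (rule suffix_trie_prefix[OF RT]) (use M in auto)
    ultimately show False using M by simp
  qed
  moreover have "R \<noteq> L" using LR by auto
  ultimately have "length R < length L" by (simp add: prefix_length_less strict_prefix_def)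
  have R_take: "R = take (length R) L" using \<open>prefix R L\<close> by (auto simp: prefix_def)
  have "length P + d \<le> length R" using QR d by (auto dest!: prefix_length_le)
  moreover have "2 \<le> freq T R"
    unfolding freq_ge_2_iff
  proof (intro bexI)
    show "i \<in> starts T R" using starts_mono[OF \<open>prefix R L\<close>] i by blast
    show "i' \<in> starts T R" using i' by (auto simp: starts_def R_def)
    show "i' \<noteq> i" by fact
  qed
  ultimately have "length R - length P \<in> implicit_nodes T P L"
    using R_take \<open>suffix R T\<close> \<open>length R < length L\<close> d by (auto simp: implicit_nodes_def Let_def)
  then show "\<exists>k \<in> implicit_nodes T P L. d \<le> k" using \<open>length P + d \<le> length R\<close> by (intro bexI) auto
qed

lemma finite_implicit_nodes [simp]: "finite (implicit_nodes T P L)"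
  by (rule finite_subset[of _ "{..length L}"]) (auto simp: implicit_nodes_def)

section \<open>Counting net occurrences\<close>

text \<open>With zero-based starts, the two extensions of an occurrence are \<open>S\<close> with a
  neighbouring character added; the guards for the ends of the text ensure that the neighbour
  exists.\<close>

lemma net_freq_eq:
  "net_freq T S = card {i \<in> starts T S. 2 \<le> freq T S \<and>
     (i = 0 \<or> freq T (T ! (i - 1) # S) = 1) \<and>
     (i + length S = length T \<or> freq T (S @ [T ! (i + length S)]) = 1)}" (is "_ = card ?N")
proof -
  have net: "net_occurrence T (Suc i) (i + length S) \<longleftrightarrow> i \<in> ?N" if i: "i \<in> starts T S" for i
  proof -
    note len = starts_length[OF i]
    have l: "substr T i (i + length S) = T ! (i - 1) # S" if "i \<noteq> 0"
    proof -
      have "i - 1 \<in> starts T (T ! (i - 1) # S)" using i that len by (auto simp: starts_Cons)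
      from substr_start[OF this] show ?thesis using that by simp
    qed
    have r: "substr T (Suc i) (Suc (i + length S)) = S @ [T ! (i + length S)]"
      if "i + length S \<noteq> length T"
    proof -
      have "i \<in> starts T (S @ [T ! (i + length S)])" using i that len by (auto simp: starts_snoc)
      from substr_start[OF this] show ?thesis by simp
    qed
    show ?thesis
      using i l r substr_start[OF i]
      by (cases "i = 0"; cases "i + length S = length T") (simp_all add: net_occurrence_def)
  qed
  have "{(i, j) \<in> occurrences T S. net_occurrence T i j} = (\<lambda>i. (Suc i, i + length S)) ` ?N"
    unfolding occurrences_eq using net by auto
  then show ?thesis
    unfolding net_freq_def by (simp only:) (rule card_image, auto simp: inj_on_def)
qed

text \<open>A net occurrence that is not at the start of the text is determined by the character to its
  left; one at the start is determined by the character to its right.\<close>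
lemma net_freq_characters:
  assumes T: "set T \<subseteq> A" and S: "2 \<le> freq T S"
  shows "net_freq T S =
    card {x \<in> A. freq T (x # S) = 1 \<and>
            (\<forall>y \<in> A. freq T (x # S @ [y]) \<noteq> 0 \<longrightarrow> freq T (S @ [y]) = 1)} +
    card {y \<in> A. freq T (S @ [y]) = 1 \<and> (\<forall>x \<in> A. freq T (x # S @ [y]) = 0)}"
    (is "_ = card ?X + card ?Y")
proof -
  define N where "N = {i \<in> starts T S.
     (i = 0 \<or> freq T (T ! (i - 1) # S) = 1) \<and>
     (i + length S = length T \<or> freq T (S @ [T ! (i + length S)]) = 1)}"
  have fin: "finite N" by (auto simp: N_def)
  have occ0: "freq T P = 0 \<longleftrightarrow> starts T P = {}" for P by (simp add: freq_eq)
  have one: "freq T P = 1 \<Longrightarrow> i \<in> starts T P \<Longrightarrow> j \<in> starts T P \<Longrightarrow> i = j" for P i j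
    unfolding freq_eq_1_iff by auto
  have ex: "freq T P = 1 \<Longrightarrow> \<exists>i. i \<in> starts T P" for P
    unfolding freq_eq_1_iff by auto
  have left: "bij_betw (\<lambda>i. T ! (i - 1)) (N - {0}) ?X"
  proof (rule bij_betwI')
    fix i j assume i: "i \<in> N - {0}" and j: "j \<in> N - {0}"
    have *: "k - 1 \<in> starts T (T ! (k - 1) # S)" if "k \<in> N - {0}" for k
      using that starts_length[of k T S] by (auto simp: starts_Cons N_def)
    show "(T ! (i - 1) = T ! (j - 1)) = (i = j)"
    proof
      assume eq: "T ! (i - 1) = T ! (j - 1)"
      have "i - 1 = j - 1" by (rule one[OF _ *[OF i]]) (use i *[OF j] eq in \<open>auto simp: N_def\<close>)
      then show "i = j" using i j by auto
    qed simp
  next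
    fix i assume i: "i \<in> N - {0}"
    then have len: "i + length S \<le> length T" using starts_length by (auto simp: N_def)
    have *: "i - 1 \<in> starts T (T ! (i - 1) # S)"
      using i len by (auto simp: starts_Cons N_def)
    have f1: "freq T (T ! (i - 1) # S) = 1" using i by (auto simp: N_def)
    \<comment> \<open>As \<open>xS\<close> occurs once, any \<open>xSy\<close> occurs there, so
      \<open>y\<close> is the actual right neighbour of the net occurrence.\<close>
    have "freq T (S @ [y]) = 1" if nz: "freq T (T ! (i - 1) # S @ [y]) \<noteq> 0" for y
    proof -
      obtain j where j: "j \<in> starts T ((T ! (i - 1) # S) @ [y])" using nz by (auto simp: occ0)
      then have "j = i - 1" using one[OF f1 _ *] unfolding starts_snoc by blast
      then have "i + length S < length T" "T ! (i + length S) = y"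
        using j i unfolding starts_snoc by auto
      then show ?thesis using i by (auto simp: N_def)
    qed
    moreover have "T ! (i - 1) \<in> A" using T len i by (auto intro!: subsetD[OF T])
    ultimately show "T ! (i - 1) \<in> ?X" using f1 by simp
  next
    \<comment> \<open>Surjectivity: the start of \<open>S\<close> inside the only \<open>xS\<close>
      is net. Its right neighbour \<open>y\<close>, if any, yields an occurring \<open>xSy\<close>,
      and membership in \<open>?X\<close> then makes \<open>Sy\<close> unique.\<close>
    fix x assume x: "x \<in> ?X"
    then obtain j where j: "j \<in> starts T (x # S)" using ex by blast
    then have Sj: "Suc j \<in> starts T S" "T ! j = x" by (auto simp: starts_Cons)
    have "freq T (S @ [T ! (Suc j + length S)]) = 1" if ne: "Suc j + length S \<noteq> length T"
    proof -
      have len: "Suc j + length S < length T" using ne starts_length[OF Sj(1)] by simp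
      then have "j \<in> starts T ((x # S) @ [T ! (Suc j + length S)])"
        using j unfolding starts_snoc by simp
      then have "freq T (x # S @ [T ! (Suc j + length S)]) \<noteq> 0" by (auto simp: occ0)
      moreover have "T ! (Suc j + length S) \<in> A" using len by (auto intro!: subsetD[OF T])
      ultimately show ?thesis using x by blast
    qed
    then show "\<exists>i \<in> N - {0}. x = T ! (i - 1)"
      using x Sj by (intro bexI[of _ "Suc j"]) (auto simp: N_def)
  qed
  \<comment> \<open>A repeated string cannot be the whole text, so an occurrence at 0 has a right
    neighbour.\<close>
  have not_whole: "length S \<noteq> length T"
  proof
    assume *: "length S = length T"
    then have "starts T S \<subseteq> {0}" using starts_length[of _ T S] by fastforce
    then show False using S by (auto simp: freq_ge_2_iff)
  qed
  have right: "bij_betw (\<lambda>i. T ! (i + length S)) (N \<inter> {0}) ?Y"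
  proof (rule bij_betwI')
    fix i assume i: "i \<in> N \<inter> {0}"
    then have len: "length S < length T" using starts_length[of 0 T S] not_whole
      by (auto simp: N_def)
    then have f1: "freq T (S @ [T ! length S]) = 1" using i by (auto simp: N_def)
    have *: "0 \<in> starts T (S @ [T ! length S])" using i len by (auto simp: starts_snoc N_def)
    \<comment> \<open>An occurrence of \<open>xSy\<close> would give \<open>Sy\<close> a positive
      start besides the one at 0.\<close>
    have "freq T (x # S @ [T ! length S]) = 0" for x
      unfolding occ0 using one[OF f1 *] starts_Cons[of _ T x "S @ [T ! length S]"] by blast
    moreover have "T ! length S \<in> A" using len by (auto intro!: subsetD[OF T])
    ultimately show "T ! (i + length S) \<in> ?Y" using i f1 by auto
  next
    fix y assume y: "y \<in> ?Y"
    then obtain j where j: "j \<in> starts T (S @ [y])" using ex by blast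
    \<comment> \<open>The character before a positive start \<open>j\<close> would turn it into an
      occurrence of some \<open>xSy\<close>, which \<open>?Y\<close> excludes.\<close>
    have "j = 0"
    proof (rule ccontr)
      assume "j \<noteq> 0"
      then have "j - 1 \<in> starts T (T ! (j - 1) # S @ [y])"
        using j starts_length[OF j] by (auto simp: starts_Cons)
      moreover have "T ! (j - 1) \<in> A"
        using starts_length[OF j] by (auto intro!: subsetD[OF T])
      ultimately show False using y by (auto simp: occ0)
    qed
    then show "\<exists>i \<in> N \<inter> {0}. y = T ! (i + length S)"
      using j y by (auto simp: starts_snoc N_def)
  qed auto
  have "net_freq T S = card N" using S by (simp add: net_freq_eq N_def)
  also have "\<dots> = card (N - {0}) + card (N \<inter> {0})"
    using card_Int_Diff[OF fin, of "{0}"] by simp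
  finally show ?thesis using left right by (simp add: bij_betw_same_card)
qed


section \<open>Loci in the stored tree\<close>

text \<open>Stored answers are ascending, so this extracts the deepest implicit node of an edge by a
  single access.\<close>

lemma sorted_list_of_set_last:
  fixes A :: "'a::linorder set"
  assumes "finite A" "A \<noteq> {}"
  shows "sorted_list_of_set A ! (card A - 1) = Max A"
proof -
  let ?xs = "sorted_list_of_set A"
  have len: "length ?xs = card A" by simp
  have pos: "card A - 1 < card A" using assms by (simp add: card_gt_0_iff)
  have "y \<le> ?xs ! (card A - 1)" if "y \<in> A" for y
  proof -
    have "y \<in> set ?xs" using that assms(1) by simp
    then obtain k where k: "k < card A" "?xs ! k = y" unfolding in_set_conv_nth len by blast
    have "?xs ! k \<le> ?xs ! (card A - 1)"
      by (rule sorted_nth_mono) (use k pos len in auto)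
    then show ?thesis using k by simp
  qed
  moreover have "?xs ! (card A - 1) \<in> A"
    using nth_mem[of "card A - 1" ?xs] pos len assms(1) by simp
  ultimately show ?thesis using assms(1) by (intro Max_eqI[symmetric])
qed

locale stored_tree =
  fixes N :: "nat set" and lab :: "nat \<Rightarrow> nat list" and D :: suffix_tree and T :: "nat list"
  assumes rep: "represents_via N lab D T"
begin

lemmas represents_conjuncts = rep[unfolded represents_via_def]
text \<open>The numeral is the position of the first conjunct kept.\<close>

lemmas represents_conjuncts4 = represents_conjuncts[THEN conjunct2, THEN conjunct2, THEN conjunct2]
lemmas represents_conjuncts7 = represents_conjuncts4[THEN conjunct2, THEN conjunct2, THEN conjunct2]

lemma char_at: "i \<in> {1..length T} \<Longrightarrow> text_char D i = T ! (i - 1)"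
  by (rule represents_conjuncts[THEN conjunct2, THEN conjunct1, rule_format])

lemma labels: "bij_betw lab N (explicit_nodes T)"
  and root_node: "root D \<in> N" and root_label: "lab (root D) = []"
  by (rule represents_conjuncts4[THEN conjunct1],
      rule represents_conjuncts4[THEN conjunct2, THEN conjunct1],
      rule represents_conjuncts4[THEN conjunct2, THEN conjunct2, THEN conjunct1])

lemma leaf_iff: "v \<in> N \<Longrightarrow> is_leaf D v \<longleftrightarrow> trie_leaf T (lab v)"
  by (rule represents_conjuncts7[THEN conjunct1, rule_format])

lemma child_iff:
  "v \<in> N \<Longrightarrow> child D v c = w \<and> w \<noteq> 0 \<longleftrightarrow>
    w \<in> N \<and> tree_edge T (lab v) (lab w) \<and> prefix (lab v @ [c]) (lab w)"
  by (rule represents_conjuncts7[THEN conjunct2, THEN conjunct1, rule_format])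

lemma stored_edge:
  assumes "v \<in> N" "tree_edge T P (lab v)"
  shows "1 \<le> edge_first D v" "edge_first D v \<le> edge_last D v" "edge_last D v \<le> length T"
    "lab v = P @ substr T (edge_first D v) (edge_last D v)"
    "implicit_count D v = card (implicit_nodes T P (lab v))"
    "m < card (implicit_nodes T P (lab v)) \<Longrightarrow>
       implicit_node D v m = sorted_list_of_set (implicit_nodes T P (lab v)) ! m"
  using represents_conjuncts7[THEN conjunct2, THEN conjunct2, THEN conjunct2, THEN conjunct2,
      unfolded Let_def, rule_format, OF assms]
  by blast+

lemma lab_explicit: "v \<in> N \<Longrightarrow> lab v \<in> explicit_nodes T"
  using labels by (auto simp: bij_betw_def)

lemma edge_length:
  assumes "v \<in> N" "tree_edge T P (lab v)"
  shows "length (lab v) = length P + (Suc (edge_last D v) - edge_first D v)"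
  using stored_edge[OF assms] by (subst stored_edge(4)[OF assms]) (auto simp: substr_def)

lemma edge_char:
  assumes "v \<in> N" "tree_edge T P (lab v)" "edge_first D v + d \<le> edge_last D v"
  shows "lab v ! (length P + d) = text_char D (edge_first D v + d)"
proof -
  note e = stored_edge[OF assms(1,2)]
  have "lab v ! (length P + d) = substr T (edge_first D v) (edge_last D v) ! d"
    by (subst e(4)) simp
  also have "\<dots> = T ! (edge_first D v - 1 + d)"
    using assms(3) e(1-3) by (auto simp: substr_def)
  also have "\<dots> = text_char D (edge_first D v + d)"
    using assms(3) e(1-3) by (subst char_at) auto
  finally show ?thesis .
qed

text \<open>\<open>v\<close> is the lower end of the edge containing \<open>Q\<close>, at distance \<open>d\<close> from its upper end; the next
  character of the edge, if there is one, is at text position \<open>i\<close>, and the last one is at \<open>j\<close>.\<close>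
definition locus :: "nat list \<Rightarrow> nat \<Rightarrow> nat \<Rightarrow> nat \<Rightarrow> nat \<Rightarrow> bool" where
  "locus Q v d i j \<longleftrightarrow>
     v \<in> N \<and>
     (Q = [] \<and> v = root D \<and> j < i \<or>
      (\<exists>P. tree_edge T P (lab v) \<and> 0 < d \<and> length P + d \<le> length (lab v) \<and>
           Q = take (length P + d) (lab v) \<and> i = edge_first D v + d \<and> j = edge_last D v))"

text \<open>Passing the last label position means that the full label has been read. The root, which
  has no edge, is encoded as an exhausted one.\<close>

lemma locus_node:
  assumes Q: "locus Q v d i j" "j < i" shows "Q = lab v"
proof (cases "Q = [] \<and> v = root D")
  case True
  then show ?thesis using root_label by simp
next
  case False
  then obtain P where v: "v \<in> N" and e: "tree_edge T P (lab v)"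
    and Q': "Q = take (length P + d) (lab v)" and ij: "i = edge_first D v + d" "j = edge_last D v"
    using Q(1) by (auto simp: locus_def)
  have "length (lab v) \<le> length P + d" using edge_length[OF v e] Q(2) ij by linarith
  then show ?thesis using Q' by simp
qed

text \<open>At an explicit node a continuation in the trie starts an edge, and the bijection of
  labels provides its stored lower node. One character of the new edge is consumed at once, hence
  distance 1 and the successor of \<open>edge_first\<close>.\<close>

lemma locus_child:
  assumes Q: "locus Q v d i j" "j < i"
  shows "Q @ [c] \<in> suffix_trie T \<longleftrightarrow> child D v c \<noteq> 0"
    and "child D v c \<noteq> 0 \<Longrightarrow>
      locus (Q @ [c]) (child D v c) 1 (Suc (edge_first D (child D v c))) (edge_last D (child D v c))"
proof -
  have v: "v \<in> N" "lab v = Q" using Q locus_node[OF Q] by (simp_all add: locus_def)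
  let ?w = "child D v c"
  have edge: "?w \<in> N" "tree_edge T Q (lab ?w)" "prefix (Q @ [c]) (lab ?w)" if "?w \<noteq> 0"
    using child_iff[OF v(1), of c ?w] v(2) that by simp_all
  show "Q @ [c] \<in> suffix_trie T \<longleftrightarrow> ?w \<noteq> 0"
  proof
    assume "Q @ [c] \<in> suffix_trie T"
    then obtain R where R: "tree_edge T Q R" "prefix (Q @ [c]) R"
      using tree_edge_exists[of Q] lab_explicit[OF v(1)] v(2) by auto
    have "R \<in> lab ` N" using R(1) labels by (simp add: bij_betw_def tree_edge_def)
    then obtain w where "w \<in> N" "lab w = R" by blast
    then show "?w \<noteq> 0" using child_iff[OF v(1), of c w] R v(2) by auto
  next
    assume "?w \<noteq> 0"
    then show "Q @ [c] \<in> suffix_trie T"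
      using edge(2) suffix_trie_prefix[OF _ edge(3)] by (simp add: tree_edge_def explicit_nodes_def)
  qed
  assume "?w \<noteq> 0"
  note edge = edge[OF this]
  have "Q @ [c] = take (length Q + 1) (lab ?w)" "length Q + 1 \<le> length (lab ?w)"
    using edge(3) by (auto simp: prefix_def)
  then show "locus (Q @ [c]) ?w 1 (Suc (edge_first D ?w)) (edge_last D ?w)"
    using edge unfolding locus_def by (intro conjI disjI2 exI[of _ Q]) auto
qed

lemma locus_next_char:
  assumes Q: "locus Q v d i j" "i \<le> j"
  shows "Q @ [c] \<in> suffix_trie T \<longleftrightarrow> c = text_char D i"
    and "c = text_char D i \<Longrightarrow> locus (Q @ [c]) v (Suc d) (Suc i) j"
proof -
  obtain P where v: "v \<in> N" and e: "tree_edge T P (lab v)" and d: "0 < d"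
    and Q': "Q = take (length P + d) (lab v)" and ij: "i = edge_first D v + d" "j = edge_last D v"
    using Q by (auto simp: locus_def)
  have len: "length P + d < length (lab v)" using edge_length[OF v e] Q(2) ij by simp
  have char: "lab v ! (length P + d) = text_char D i"
    using edge_char[OF v e] Q(2) ij by simp
  have lQ: "length Q = length P + d" using len Q' by simp
  have "strict_prefix Q (lab v)"
    using len lQ Q' take_is_prefix[of "length P + d" "lab v"] by (auto simp: strict_prefix_def)
  then show "Q @ [c] \<in> suffix_trie T \<longleftrightarrow> c = text_char D i"
    using tree_edge_interior[OF e, of Q c] d lQ char by simp
  assume "c = text_char D i"
  then have "Q @ [c] = take (length P + Suc d) (lab v)"
    using len char Q' by (simp add: take_Suc_conv_app_nth)
  then show "locus (Q @ [c]) v (Suc d) (Suc i) j"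
    using v e len ij unfolding locus_def by (intro conjI disjI2 exI[of _ P]) auto
qed

text \<open>A prefix of a repeated node label is repeated, which settles edges to non-leaves. On an
  edge to a leaf, some implicit node lies at distance at least \<open>d\<close> iff the last stored
  one does.\<close>

lemma locus_freq:
  assumes Q: "locus Q v d i j" and T: "T \<noteq> []"
  shows "2 \<le> freq T Q \<longleftrightarrow> \<not> is_leaf D v \<or>
    0 < implicit_count D v \<and> d \<le> implicit_node D v (implicit_count D v - 1)"
proof (cases "is_leaf D v")
  case False
  have v: "v \<in> N" and "prefix Q (lab v)"
    using Q root_label take_is_prefix by (auto simp: locus_def)
  moreover have "2 \<le> freq T (lab v)"
    using explicit_inner_freq lab_explicit[OF v] leaf_iff[OF v] False T by blast
  ultimately show ?thesis using False freq_antimono[of Q "lab v" T] by simp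
next
  case True
  have v: "v \<in> N" using Q by (simp add: locus_def)
  have leaf: "trie_leaf T (lab v)" using True v leaf_iff by blast
  \<comment> \<open>The empty string is repeated in a nonempty text, so the root is not a leaf and
    the locus lies on an edge.\<close>
  have "2 \<le> freq T []" using T by (cases T) (auto simp: freq_eq starts_Nil)
  then have "v \<noteq> root D" using trie_leaf_freq[OF leaf] root_label by auto
  then obtain P where e: "tree_edge T P (lab v)" and d: "0 < d" "length P + d \<le> length (lab v)"
    and Q': "Q = take (length P + d) (lab v)"
    using Q by (auto simp: locus_def)
  define I where "I = implicit_nodes T P (lab v)"
  have count: "implicit_count D v = card I" and fin: "finite I"
    using stored_edge(5)[OF v e] by (simp_all add: I_def)
  have "(\<exists>k \<in> I. d \<le> k) \<longleftrightarrow> I \<noteq> {} \<and> d \<le> Max I"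
    using Max_ge_iff[OF fin] by (cases "I = {}") simp_all
  also have "\<dots> \<longleftrightarrow> 0 < card I \<and> d \<le> implicit_node D v (card I - 1)"
  proof (cases "I = {}")
    case False
    then have c: "0 < card I" using fin by (simp add: card_gt_0_iff)
    have "implicit_node D v (card I - 1) = sorted_list_of_set I ! (card I - 1)"
      using stored_edge(6)[OF v e, of "card I - 1"] c by (simp add: I_def)
    also have "\<dots> = Max I"
      by (rule sorted_list_of_set_last[OF fin False])
    finally show ?thesis using False c by simp
  qed simp
  finally show ?thesis
    using leaf_edge_freq[OF e leaf d] True count by (simp add: I_def Q')
qed

end


section \<open>Running times\<close>

fun loop_free :: "prog \<Rightarrow> bool" where
  "loop_free (Seq p q) \<longleftrightarrow> loop_free p \<and> loop_free q"
| "loop_free (If b p q) \<longleftrightarrow> loop_free p \<and> loop_free q"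
| "loop_free (While b p) \<longleftrightarrow> False"
| "loop_free _ \<longleftrightarrow> True"

text \<open>\<open>max_cost\<close> and \<open>exec\<close> are meant for loop-free programs; their
  values at \<open>While\<close> are defaults.\<close>

fun max_cost :: "prog \<Rightarrow> nat" where
  "max_cost Skip = 1"
| "max_cost (Assign r a) = Suc (exp_cost a)"
| "max_cost (Seq p q) = max_cost p + max_cost q"
| "max_cost (If b p q) = test_cost b + max (max_cost p) (max_cost q)"
| "max_cost (While b p) = 0"

fun exec :: "suffix_tree \<Rightarrow> nat list \<Rightarrow> prog \<Rightarrow> (nat \<Rightarrow> nat) \<Rightarrow> nat \<Rightarrow> nat" where
  "exec D S Skip s = s"
| "exec D S (Assign r a) s = s(r := eval D S s a)"
| "exec D S (Seq p q) s = exec D S q (exec D S p s)"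
| "exec D S (If b p q) s = (if holds D S s b then exec D S p s else exec D S q s)"
| "exec D S (While b p) s = s"

lemma runs_exec: "loop_free p \<Longrightarrow> \<exists>t \<le> max_cost p. runs D S p s t (exec D S p s)"
proof (induction p arbitrary: s)
  case (Seq p q)
  then obtain t t' where "t \<le> max_cost p" "runs D S p s t (exec D S p s)"
    "t' \<le> max_cost q" "runs D S q (exec D S p s) t' (exec D S (Seq p q) s)"
    by fastforce
  then show ?case by (intro exI[of _ "t + t'"]) (auto intro: runs_Seq)
next
  case (If b p q)
  then obtain t t' where "t \<le> max_cost p" "runs D S p s t (exec D S p s)"
    "t' \<le> max_cost q" "runs D S q s t' (exec D S q s)"
    by fastforce
  then show ?case
    by (intro exI[of _ "test_cost b + (if holds D S s b then t else t')"])
      (auto intro: runs_IfTrue runs_IfFalse)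
qed (use runs_Skip runs_Assign in \<open>fastforce+\<close>)

text \<open>Total correctness with a time budget, from one given start state. As in a Hoare logic,
  the rules below add budgets under composition.\<close>

definition runs_within ::
  "suffix_tree \<Rightarrow> nat list \<Rightarrow> prog \<Rightarrow> (nat \<Rightarrow> nat) \<Rightarrow> nat \<Rightarrow> ((nat \<Rightarrow> nat) \<Rightarrow> bool) \<Rightarrow> bool" where
  "runs_within D S p s b Q \<longleftrightarrow> (\<exists>t s'. runs D S p s t s' \<and> t \<le> b \<and> Q s')"

lemma runs_within_mono:
  "runs_within D S p s b Q \<Longrightarrow> b \<le> b' \<Longrightarrow> (\<And>s'. Q s' \<Longrightarrow> Q' s') \<Longrightarrow> runs_within D S p s b' Q'"
  unfolding runs_within_def by (meson le_trans)

lemma runs_within_loop_free: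
  "loop_free p \<Longrightarrow> max_cost p \<le> b \<Longrightarrow> Q (exec D S p s) \<Longrightarrow> runs_within D S p s b Q"
  unfolding runs_within_def using runs_exec by (meson le_trans)

lemma runs_within_Seq:
  assumes "runs_within D S p s b R" "\<And>s'. R s' \<Longrightarrow> runs_within D S q s' b' Q"
  shows "runs_within D S (Seq p q) s (b + b') Q"
  using assms unfolding runs_within_def by (meson add_mono runs_Seq)

lemma runs_within_If:
  assumes "holds D S s c \<Longrightarrow> runs_within D S p s b Q" "\<not> holds D S s c \<Longrightarrow> runs_within D S q s b Q"
  shows "runs_within D S (If c p q) s (test_cost c + b) Q"
  using assms unfolding runs_within_def
  by (cases "holds D S s c") (meson add_left_mono runs_IfTrue runs_IfFalse)+

lemma runs_within_WhileFalse:
  "\<not> holds D S s c \<Longrightarrow> Q s \<Longrightarrow> runs_within D S (While c p) s (test_cost c) Q"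
  unfolding runs_within_def using runs_WhileFalse by blast

lemma runs_within_WhileTrue:
  assumes "holds D S s c" "runs_within D S p s b R" "\<And>s'. R s' \<Longrightarrow> runs_within D S (While c p) s' b' Q"
  shows "runs_within D S (While c p) s (test_cost c + b + b') Q"
  using assms unfolding runs_within_def by (meson add_mono order_refl runs_WhileTrue)

text \<open>A loop over a fixed list is unrolled into the program text, so the number of its rounds
  is fixed with the program.\<close>

fun each :: "(nat \<Rightarrow> prog) \<Rightarrow> nat list \<Rightarrow> prog" where
  "each f [] = Skip"
| "each f (x # xs) = Seq (f x) (each f xs)"

text \<open>The invariant \<open>J\<close> is indexed by the elements already handled; an arbitrary
  initial \<open>zs\<close> lets the induction pass elements into that prefix.\<close>

lemma runs_within_each:
  assumes "\<And>zs x s. J zs s \<Longrightarrow> x \<in> set xs \<Longrightarrow> runs_within D S (f x) s b (J (zs @ [x]))"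
    and "J zs s"
  shows "runs_within D S (each f xs) s (length xs * b + 1) (J (zs @ xs))"
  using assms
proof (induction xs arbitrary: zs s)
  case Nil
  then show ?case by (intro runs_within_loop_free) auto
next
  case (Cons x xs)
  have "runs_within D S (each f (x # xs)) s (b + (length xs * b + 1)) (J ((zs @ [x]) @ xs))"
    unfolding each.simps
  proof (rule runs_within_Seq)
    show "runs_within D S (f x) s b (J (zs @ [x]))" using Cons.prems by simp
    show "runs_within D S (each f xs) s' (length xs * b + 1) (J ((zs @ [x]) @ xs))"
      if "J (zs @ [x]) s'" for s'
      by (rule Cons.IH[OF Cons.prems(1) that]) auto
  qed
  then show ?case by simp
qed

section \<open>The query program\<close>

text \<open>Registers 3, 4, 5 and 6 hold the locus of the characters read so far; register 2 is 0 if they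
  do not occur in the text.\<close>
definition step :: "exp \<Rightarrow> prog" where
  "step c =
     If (Less (Lit 0) (Reg 2))
       (If (Less (Reg 5) (Reg 4))
          (Seq (Assign 3 (Op2 Child (Reg 3) c))
            (If (Less (Lit 0) (Reg 3))
              (Seq (Assign 4 (Op1 Succ (Op1 EdgeFirst (Reg 3))))
                (Seq (Assign 5 (Op1 EdgeLast (Reg 3))) (Assign 6 (Lit 1))))
              (Assign 2 (Lit 0))))
          (If (Conj (Neg (Less c (Op1 TextChar (Reg 4)))) (Neg (Less (Op1 TextChar (Reg 4)) c)))
            (Seq (Assign 4 (Op1 Succ (Reg 4))) (Assign 6 (Op1 Succ (Reg 6))))
            (Assign 2 (Lit 0))))
       Skip"

text \<open>Upgrades the presence flag in register 2 to a frequency capped at 2. A flag of 1 is kept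
  exactly on an edge to a leaf with no implicit node at or below the locus.\<close>

definition finish :: prog where
  "finish =
     If (Less (Lit 0) (Reg 2))
       (If (Conj (Less (Lit 0) (Op1 IsLeaf (Reg 3)))
              (Neg (Conj (Less (Lit 0) (Op1 ImplicitCount (Reg 3)))
                (Neg (Less (Op2 ImplicitNode (Reg 3) (Op2 Minus (Op1 ImplicitCount (Reg 3)) (Lit 1)))
                  (Reg 6))))))
         Skip (Assign 2 (Lit 2)))
       Skip"

text \<open>The empty range from 1 to 0 in registers 4 and 5 marks the root as an exhausted edge, so
  the first step takes a child. Register 7 counts the query characters read.\<close>

definition start :: prog where
  "start = Seq (Assign 2 (Lit 1)) (Seq (Assign 3 (Op0 Root))
     (Seq (Assign 4 (Lit 1)) (Seq (Assign 5 (Lit 0)) (Assign 7 (Lit 0)))))"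

definition scan :: prog where
  "scan = While (Less (Reg 7) (Op0 QueryLen))
     (Seq (step (Op1 QueryChar (Op1 Succ (Reg 7)))) (Assign 7 (Op1 Succ (Reg 7))))"

text \<open>A single routine serves \<open>S\<close>, \<open>xS\<close>, \<open>Sy\<close> and
  \<open>xSy\<close>; the added characters are literals of the program, and only \<open>S\<close> is
  read from the input.\<close>

definition descend :: "nat list \<Rightarrow> nat list \<Rightarrow> prog" where
  "descend pre post = Seq start (Seq (each (\<lambda>x. step (Lit x)) pre)
     (Seq scan (Seq (each (\<lambda>x. step (Lit x)) post) finish)))"

lemma loop_free_step [simp]: "loop_free (step c)"
  and loop_free_finish [simp]: "loop_free finish"
  and loop_free_start [simp]: "loop_free start"
  by (simp_all add: step_def finish_def start_def)

lemma exec_step_other: "r \<notin> {2, 3, 4, 5, 6} \<Longrightarrow> exec D S (step c) s r = s r"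
  by (simp add: step_def)

lemma max_cost_step: "max_cost (step c) \<le> 25 + 3 * exp_cost c"
  by (simp add: step_def)

section \<open>Correctness and cost of a descent\<close>

context stored_tree
begin

definition located :: "nat list \<Rightarrow> (nat \<Rightarrow> nat) \<Rightarrow> bool" where
  "located Q s \<longleftrightarrow>
     s 2 = 0 \<and> Q \<notin> suffix_trie T \<or>
     s 2 = 1 \<and> Q \<in> suffix_trie T \<and> locus Q (s 3) (s 6) (s 4) (s 5)"

text \<open>Absent strings stay absent because the trie is closed under prefixes; otherwise the
  cases are an exhausted edge and a position inside one.\<close>

lemma located_step:
  assumes "located Q s" and c: "eval D S s c = x"
  shows "located (Q @ [x]) (exec D S (step c) s)"
proof (cases "s 2 = 0")
  case True
  then have "Q @ [x] \<notin> suffix_trie T"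
    using assms(1) suffix_trie_prefix[of "Q @ [x]" T Q] by (auto simp: located_def)
  then show ?thesis using True by (simp add: located_def step_def)
next
  case False
  then have Q: "s 2 = 1" "locus Q (s 3) (s 6) (s 4) (s 5)"
    using assms(1) by (auto simp: located_def)
  show ?thesis
  proof (cases "s 5 < s 4")
    case True
    then show ?thesis
      using locus_child[OF Q(2) True, of x] Q(1) c by (simp add: located_def step_def)
  next
    case False
    then show ?thesis
      using locus_next_char[OF Q(2), of x] Q(1) c by (auto simp: located_def step_def)
  qed
qed

lemma finish_freq:
  assumes "located Q s" "T \<noteq> []"
  shows "exec D S finish s 2 = min 2 (freq T Q)"
proof (cases "s 2 = 0")
  case True
  then show ?thesis using assms(1) by (auto simp: located_def finish_def suffix_trie_freq)
next
  case False
  then have Q: "s 2 = 1" "locus Q (s 3) (s 6) (s 4) (s 5)" "0 < freq T Q"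
    using assms(1) by (auto simp: located_def suffix_trie_freq)
  show ?thesis
  proof (cases "2 \<le> freq T Q")
    case True
    then have "exec D S finish s 2 = 2"
      using locus_freq[OF Q(2) assms(2)] Q(1) by (auto simp: finish_def)
    then show ?thesis using True by simp
  next
    case False
    then have "exec D S finish s 2 = 1"
      using locus_freq[OF Q(2) assms(2)] Q(1) by (auto simp: finish_def)
    then show ?thesis using False Q(3) by simp
  qed
qed

lemma start_located: "located [] (exec D S start s)"
  using root_node by (simp add: located_def start_def locus_def suffix_trie_iff starts_Nil)

lemma runs_within_steps:
  assumes "located Q s"
  shows "runs_within D S (each (\<lambda>x. step (Lit x)) xs) s (length xs * 28 + 1)
    (\<lambda>s'. located (Q @ xs) s' \<and> s' 0 = s 0 \<and> s' 1 = s 1 \<and> s' 7 = s 7)"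
proof -
  let ?J = "\<lambda>zs s'. located (Q @ zs) s' \<and> s' 0 = s 0 \<and> s' 1 = s 1 \<and> s' 7 = s 7"
  have "runs_within D S (each (\<lambda>x. step (Lit x)) xs) s (length xs * 28 + 1) (?J ([] @ xs))"
  proof (rule runs_within_each)
    fix zs x s' assume "?J zs s'"
    then show "runs_within D S (step (Lit x)) s' 28 (?J (zs @ [x]))"
      using located_step[of "Q @ zs" s' S "Lit x" x] max_cost_step[of "Lit x"]
      by (intro runs_within_loop_free) (auto simp: exec_step_other)
  qed (use assms in auto)
  then show ?thesis by simp
qed

text \<open>A round costs at most 50, of which 3 go to the loop test and 47 to the body; the last 3
  pay for the failing test.\<close>

lemma runs_within_scan:
  assumes "located (Q @ take k S) s" "s 7 = k" "k \<le> length S"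
  shows "runs_within D S scan s ((length S - k) * 50 + 3)
    (\<lambda>s'. located (Q @ S) s' \<and> s' 0 = s 0 \<and> s' 1 = s 1)"
  using assms
proof (induction "length S - k" arbitrary: k s)
  case 0
  then have "runs_within D S scan s 3
    (\<lambda>s'. located (Q @ S) s' \<and> s' 0 = s 0 \<and> s' 1 = s 1)"
    unfolding scan_def by (intro runs_within_mono[OF runs_within_WhileFalse, of D S s _ "\<lambda>s'. s' = s"]) auto
  then show ?case using 0 by simp
next
  case (Suc m)
  let ?J = "\<lambda>s'. located (Q @ take (Suc k) S) s' \<and> s' 7 = Suc k \<and> s' 0 = s 0 \<and> s' 1 = s 1"
  let ?c = "Op1 QueryChar (Op1 Succ (Reg 7))"
  have k: "k < length S" using Suc.hyps by simp
  have c: "eval D S s ?c = S ! k" using k Suc.prems by simp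
  have body: "runs_within D S (Seq (step ?c) (Assign 7 (Op1 Succ (Reg 7)))) s 47 ?J"
  proof (rule runs_within_loop_free)
    have "located (Q @ take (Suc k) S) (exec D S (step ?c) s)"
      using located_step[OF Suc.prems(1) c] k by (simp add: take_Suc_conv_app_nth)
    then show "?J (exec D S (Seq (step ?c) (Assign 7 (Op1 Succ (Reg 7)))) s)"
      using Suc.prems by (simp add: exec_step_other located_def)
  qed (use max_cost_step[of ?c] in simp_all)
  have rest: "runs_within D S scan s' ((length S - Suc k) * 50 + 3)
      (\<lambda>s'. located (Q @ S) s' \<and> s' 0 = s 0 \<and> s' 1 = s 1)" if "?J s'" for s'
    using Suc.hyps(1)[of "Suc k" s'] Suc.hyps(2) that k by auto
  have "runs_within D S scan s (3 + 47 + ((length S - Suc k) * 50 + 3))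
      (\<lambda>s'. located (Q @ S) s' \<and> s' 0 = s 0 \<and> s' 1 = s 1)"
    using runs_within_WhileTrue[OF _ body rest[unfolded scan_def]]
      k Suc.prems by (simp add: scan_def)
  then show ?case by (rule runs_within_mono) (use k in auto)
qed

lemma runs_within_descend:
  assumes "T \<noteq> []" "length pre \<le> 1" "length post \<le> 1"
  shows "runs_within D S (descend pre post) s (200 * max 1 (length S))
    (\<lambda>s'. s' 2 = min 2 (freq T (pre @ S @ post)) \<and> s' 0 = s 0 \<and> s' 1 = s 1)"
proof -
  let ?P = "\<lambda>s'. s' 0 = s 0 \<and> s' 1 = s 1"
  \<comment> \<open>The summands pay for \<open>start\<close>, \<open>pre\<close>,
    \<open>scan\<close>, \<open>post\<close> and \<open>finish\<close>. With at most one character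
    in each of \<open>pre\<close> and \<open>post\<close> they stay below
    \<open>101 + 50 * length S + 1\<close>, which the factor 200 covers.\<close>
  have "runs_within D S (descend pre post) s
    (10 + ((length pre * 28 + 1) + ((length S * 50 + 3) + ((length post * 28 + 1) + 30))))
    (\<lambda>s'. s' 2 = min 2 (freq T (pre @ S @ post)) \<and> ?P s')"
    unfolding descend_def
  proof (rule runs_within_Seq)
    show "runs_within D S start s 10 (\<lambda>s'. located [] s' \<and> s' 7 = 0 \<and> ?P s')"
      using start_located by (intro runs_within_loop_free) (auto simp: start_def)
  next
    fix s1 assume 1: "located [] s1 \<and> s1 7 = 0 \<and> ?P s1"
    show "runs_within D S (Seq (each (\<lambda>x. step (Lit x)) pre)
        (Seq scan (Seq (each (\<lambda>x. step (Lit x)) post) finish))) s1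
      ((length pre * 28 + 1) + ((length S * 50 + 3) + ((length post * 28 + 1) + 30)))
      (\<lambda>s'. s' 2 = min 2 (freq T (pre @ S @ post)) \<and> ?P s')"
    proof (rule runs_within_Seq)
      show "runs_within D S (each (\<lambda>x. step (Lit x)) pre) s1 (length pre * 28 + 1)
          (\<lambda>s'. located pre s' \<and> s' 7 = 0 \<and> ?P s')"
        by (rule runs_within_mono[OF runs_within_steps[of "[]"]]) (use 1 in auto)
    next
      fix s2 assume 2: "located pre s2 \<and> s2 7 = 0 \<and> ?P s2"
      show "runs_within D S (Seq scan (Seq (each (\<lambda>x. step (Lit x)) post) finish)) s2
        ((length S * 50 + 3) + ((length post * 28 + 1) + 30))
        (\<lambda>s'. s' 2 = min 2 (freq T (pre @ S @ post)) \<and> ?P s')"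
      proof (rule runs_within_Seq)
        show "runs_within D S scan s2 (length S * 50 + 3) (\<lambda>s'. located (pre @ S) s' \<and> ?P s')"
          by (rule runs_within_mono[OF runs_within_scan[of pre 0]]) (use 2 in auto)
      next
        fix s3 assume 3: "located (pre @ S) s3 \<and> ?P s3"
        show "runs_within D S (Seq (each (\<lambda>x. step (Lit x)) post) finish) s3 ((length post * 28 + 1) + 30)
          (\<lambda>s'. s' 2 = min 2 (freq T (pre @ S @ post)) \<and> ?P s')"
        proof (rule runs_within_Seq)
          show "runs_within D S (each (\<lambda>x. step (Lit x)) post) s3 (length post * 28 + 1)
              (\<lambda>s'. located ((pre @ S) @ post) s' \<and> ?P s')"
            by (rule runs_within_mono[OF runs_within_steps]) (use 3 in auto)
        next
          fix s4 assume 4: "located ((pre @ S) @ post) s4 \<and> ?P s4"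
          then have "exec D S finish s4 2 = min 2 (freq T (pre @ S @ post))"
            using finish_freq assms(1) by fastforce
          moreover have "?P (exec D S finish s4)" using 4 by (simp add: finish_def)
          ultimately show "runs_within D S finish s4 30
              (\<lambda>s'. s' 2 = min 2 (freq T (pre @ S @ post)) \<and> ?P s')"
            by (intro runs_within_loop_free) (auto simp: finish_def)
        qed
      qed
    qed
  qed
  then show ?thesis by (rule runs_within_mono) (use assms in auto)
qed

end

section \<open>Tests by neighbouring characters and the final count\<close>

definition is_one :: test where
  "is_one = Conj (Less (Lit 0) (Reg 2)) (Less (Reg 2) (Lit 2))"

lemma holds_is_one: "s 2 = min 2 k \<Longrightarrow> holds D S s is_one \<longleftrightarrow> k = 1"
  by (auto simp: is_one_def min_def)

text \<open>The tests leave their truth value in register 1; register 0 is the running count.\<close>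
definition left_test :: "nat list \<Rightarrow> nat \<Rightarrow> prog" where
  "left_test cs x =
     Seq (descend [x] [])
       (If is_one
         (Seq (Assign 1 (Lit 1))
           (each (\<lambda>y. Seq (descend [] [y])
              (If is_one Skip
                (Seq (descend [x] [y])
                  (If (Less (Lit 0) (Reg 2)) (Assign 1 (Lit 0)) Skip)))) cs))
         (Assign 1 (Lit 0)))"

definition right_test :: "nat list \<Rightarrow> nat \<Rightarrow> prog" where
  "right_test cs y =
     Seq (descend [] [y])
       (If is_one
         (Seq (Assign 1 (Lit 1))
           (each (\<lambda>x. Seq (descend [x] [y])
              (If (Less (Lit 0) (Reg 2)) (Assign 1 (Lit 0)) Skip)) cs))
         (Assign 1 (Lit 0)))"

definition count :: "(nat \<Rightarrow> prog) \<Rightarrow> nat list \<Rightarrow> prog" where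
  "count f cs = each (\<lambda>x. Seq (f x)
     (If (Less (Lit 0) (Reg 1)) (Assign 0 (Op1 Succ (Reg 0))) Skip)) cs"

text \<open>The empty text is treated apart: its root is a leaf, and implicit nodes are stored only for
  edges.\<close>
definition net_freq_prog :: "nat list \<Rightarrow> prog" where
  "net_freq_prog cs =
     If (Less (Lit 0) (Op0 TextLen))
       (Seq (descend [] [])
         (If (Less (Lit 1) (Reg 2))
           (Seq (count (left_test cs) cs) (count (right_test cs) cs))
           Skip))
       Skip"

lemma runs_within_count:
  assumes "\<And>x s. x \<in> set cs \<Longrightarrow>
    runs_within D S (f x) s b (\<lambda>s'. s' 1 = of_bool (P x) \<and> s' 0 = s 0)"
  shows "runs_within D S (count f cs) s (length cs * (b + 10) + 1)
    (\<lambda>s'. s' 0 = s 0 + length (filter P cs))"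
proof -
  let ?J = "\<lambda>zs (s' :: nat \<Rightarrow> nat). s' 0 = s 0 + length (filter P zs)"
  have "runs_within D S (count f cs) s (length cs * (b + 10) + 1) (?J ([] @ cs))"
    unfolding count_def
  proof (rule runs_within_each)
    fix zs x and s1 :: "nat \<Rightarrow> nat" assume J: "s1 0 = s 0 + length (filter P zs)" and x: "x \<in> set cs"
    show "runs_within D S (Seq (f x)
        (If (Less (Lit 0) (Reg 1)) (Assign 0 (Op1 Succ (Reg 0))) Skip)) s1 (b + 10) (?J (zs @ [x]))"
      by (rule runs_within_Seq[OF assms[OF x]], rule runs_within_loop_free) (use J in auto)
  qed simp
  then show ?thesis by simp
qed

context stored_tree
begin

text \<open>One descent along \<open>xS\<close>, then up to two for each \<open>y\<close>: along
  \<open>Sy\<close> and, if that is not unique, along \<open>xSy\<close>. This explains 200 and 400.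
  Register 1 is the conjunction over the \<open>y\<close> handled so far.\<close>

lemma runs_within_left_test:
  assumes T: "T \<noteq> []"
  shows "runs_within D S (left_test cs x) s
    (200 * max 1 (length S) + (10 + length cs * (400 * max 1 (length S) + 30)))
    (\<lambda>s'. s' 1 = of_bool (freq T (x # S) = 1 \<and>
        (\<forall>y \<in> set cs. freq T (x # S @ [y]) \<noteq> 0 \<longrightarrow> freq T (S @ [y]) = 1)) \<and> s' 0 = s 0)"
    (is "runs_within _ _ _ _ (?m + _) ?Q")
proof -
  let ?P = "\<lambda>y. freq T (x # S @ [y]) \<noteq> 0 \<longrightarrow> freq T (S @ [y]) = 1"
  let ?J = "\<lambda>zs (s' :: nat \<Rightarrow> nat). s' 1 = of_bool (\<forall>y \<in> set zs. ?P y) \<and> s' 0 = s 0"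
  let ?body = "\<lambda>y. Seq (descend [] [y]) (If is_one Skip
    (Seq (descend [x] [y]) (If (Less (Lit 0) (Reg 2)) (Assign 1 (Lit 0)) Skip)))"
  have body: "runs_within D S (?body y) s1 (400 * max 1 (length S) + 30) (?J (zs @ [y]))"
    if J: "?J zs s1" for zs y s1
  proof -
    have "runs_within D S (?body y) s1 (?m + (test_cost is_one + (?m + 6))) (?J (zs @ [y]))"
    proof (rule runs_within_Seq[OF runs_within_descend[OF T]], goal_cases)
      \<comment> \<open>Goals 1 and 2 are the length conditions on the added characters.\<close>
      case (3 s2)
      show ?case
      proof (rule runs_within_If)
        assume "holds D S s2 is_one"
        then have "freq T (S @ [y]) = 1" using 3 by (auto simp: holds_is_one)
        then show "runs_within D S Skip s2 (?m + 6) (?J (zs @ [y]))"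
          using J 3 by (intro runs_within_loop_free) auto
      next
        assume "\<not> holds D S s2 is_one"
        then have ne: "freq T (S @ [y]) \<noteq> 1" using 3 by (auto simp: holds_is_one)
        show "runs_within D S (Seq (descend [x] [y])
            (If (Less (Lit 0) (Reg 2)) (Assign 1 (Lit 0)) Skip)) s2 (?m + 6) (?J (zs @ [y]))"
          by (rule runs_within_Seq[OF runs_within_descend[OF T]], simp, simp,
              rule runs_within_loop_free) (use J 3 ne in auto)
      qed
    qed simp_all
    then show ?thesis by (rule runs_within_mono) (simp_all add: is_one_def)
  qed
  \<comment> \<open>Besides the first descent and the product, the cost is 7 for
    \<open>is_one\<close>, 2 for setting the flag and 1 for the final \<open>Skip\<close>, together
    the 10 of the statement.\<close>
  let ?each = "?m + (test_cost is_one + (2 + (length cs * (400 * max 1 (length S) + 30) + 1)))"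
  have "runs_within D S (left_test cs x) s ?each ?Q"
    unfolding left_test_def
  proof (rule runs_within_Seq[OF runs_within_descend[OF T]], goal_cases)
    case (3 s1)
    show ?case
    proof (rule runs_within_If)
      assume "holds D S s1 is_one"
      then have one: "freq T (x # S) = 1" using 3 by (auto simp: holds_is_one)
      show "runs_within D S (Seq (Assign 1 (Lit 1)) (each ?body cs)) s1
          (2 + (length cs * (400 * max 1 (length S) + 30) + 1)) ?Q"
      proof (rule runs_within_Seq)
        show "runs_within D S (Assign 1 (Lit 1)) s1 2 (?J [])"
          using 3 by (intro runs_within_loop_free) auto
      next
        fix s2 :: "nat \<Rightarrow> nat" assume "?J [] s2"
        then have "runs_within D S (each ?body cs) s2
            (length cs * (400 * max 1 (length S) + 30) + 1) (?J ([] @ cs))"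
          by (intro runs_within_each body)
        then show "runs_within D S (each ?body cs) s2
            (length cs * (400 * max 1 (length S) + 30) + 1) ?Q"
          by (rule runs_within_mono) (use one in auto)
      qed
    next
      assume "\<not> holds D S s1 is_one"
      then have "freq T (x # S) \<noteq> 1" using 3 by (auto simp: holds_is_one)
      then show "runs_within D S (Assign 1 (Lit 0)) s1
          (2 + (length cs * (400 * max 1 (length S) + 30) + 1)) ?Q"
        using 3 by (intro runs_within_loop_free) auto
    qed
  qed simp_all
  then show ?thesis by (rule runs_within_mono) (simp_all add: is_one_def)
qed

text \<open>Only one descent per \<open>x\<close> is made; the looser bound of the left test is kept
  so that both counts share one budget.\<close>

lemma runs_within_right_test:
  assumes T: "T \<noteq> []"
  shows "runs_within D S (right_test cs y) s
    (200 * max 1 (length S) + (10 + length cs * (400 * max 1 (length S) + 30)))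
    (\<lambda>s'. s' 1 = of_bool (freq T (S @ [y]) = 1 \<and>
        (\<forall>x \<in> set cs. freq T (x # S @ [y]) = 0)) \<and> s' 0 = s 0)"
    (is "runs_within _ _ _ _ (?m + _) ?Q")
proof -
  let ?J = "\<lambda>zs (s' :: nat \<Rightarrow> nat). s' 1 = of_bool (\<forall>x \<in> set zs. freq T (x # S @ [y]) = 0) \<and> s' 0 = s 0"
  let ?body = "\<lambda>x. Seq (descend [x] [y]) (If (Less (Lit 0) (Reg 2)) (Assign 1 (Lit 0)) Skip)"
  have body: "runs_within D S (?body x) s1 (400 * max 1 (length S) + 30) (?J (zs @ [x]))"
    if J: "?J zs s1" for zs x s1
  proof -
    have "runs_within D S (?body x) s1 (?m + 6) (?J (zs @ [x]))"
      by (rule runs_within_Seq[OF runs_within_descend[OF T]], simp, simp,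
          rule runs_within_loop_free) (use J in auto)
    then show ?thesis by (rule runs_within_mono) simp_all
  qed
  let ?each = "?m + (test_cost is_one + (2 + (length cs * (400 * max 1 (length S) + 30) + 1)))"
  have "runs_within D S (right_test cs y) s ?each ?Q"
    unfolding right_test_def
  proof (rule runs_within_Seq[OF runs_within_descend[OF T]], goal_cases)
    case (3 s1)
    show ?case
    proof (rule runs_within_If)
      assume "holds D S s1 is_one"
      then have one: "freq T (S @ [y]) = 1" using 3 by (auto simp: holds_is_one)
      show "runs_within D S (Seq (Assign 1 (Lit 1)) (each ?body cs)) s1
          (2 + (length cs * (400 * max 1 (length S) + 30) + 1)) ?Q"
      proof (rule runs_within_Seq)
        show "runs_within D S (Assign 1 (Lit 1)) s1 2 (?J [])"
          using 3 by (intro runs_within_loop_free) auto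
      next
        fix s2 :: "nat \<Rightarrow> nat" assume "?J [] s2"
        then have "runs_within D S (each ?body cs) s2
            (length cs * (400 * max 1 (length S) + 30) + 1) (?J ([] @ cs))"
          by (intro runs_within_each body)
        then show "runs_within D S (each ?body cs) s2
            (length cs * (400 * max 1 (length S) + 30) + 1) ?Q"
          by (rule runs_within_mono) (use one in auto)
      qed
    next
      assume "\<not> holds D S s1 is_one"
      then have "freq T (S @ [y]) \<noteq> 1" using 3 by (auto simp: holds_is_one)
      then show "runs_within D S (Assign 1 (Lit 0)) s1
          (2 + (length cs * (400 * max 1 (length S) + 30) + 1)) ?Q"
        using 3 by (intro runs_within_loop_free) auto
    qed
  qed simp_all
  then show ?thesis by (rule runs_within_mono) (simp_all add: is_one_def)
qed

text \<open>Position 0 is the only possible start in an empty text, so nothing repeats; this agrees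
  with the initial 0 in register 0 when the program skips.\<close>

lemma net_freq_Nil: "net_freq [] S = 0"
proof -
  have "starts [] S \<subseteq> {0}" by (auto simp: starts_def)
  then have "freq [] S \<le> 1" unfolding freq_eq using card_mono[of "{0}"] by simp
  then show ?thesis by (simp add: net_freq_eq)
qed

lemma runs_within_net_freq_prog:
  assumes T: "set T \<subseteq> {..<\<sigma>}" and s: "s 0 = 0"
  shows "runs_within D S (net_freq_prog [0..<\<sigma>]) s
    ((2 * \<sigma> * (430 * \<sigma> + 220) + 220) * max 1 (length S)) (\<lambda>s'. s' 0 = net_freq T S)"
proof -
  define m where "m = max 1 (length S)"
  define cs where "cs = [0..<\<sigma>]"
  have cs: "length cs = \<sigma>" "set cs = {..<\<sigma>}" by (auto simp: cs_def)
  \<comment> \<open>The budget of one test plus 10 for the conditional increment.\<close>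
  define b where "b = 200 * m + (10 + \<sigma> * (400 * m + 30)) + 10"
  define X where "X x \<longleftrightarrow> freq T (x # S) = 1 \<and>
    (\<forall>y \<in> {..<\<sigma>}. freq T (x # S @ [y]) \<noteq> 0 \<longrightarrow> freq T (S @ [y]) = 1)" for x
  define Y where "Y y \<longleftrightarrow> freq T (S @ [y]) = 1 \<and>
    (\<forall>x \<in> {..<\<sigma>}. freq T (x # S @ [y]) = 0)" for y
  have "length (filter P cs) = card {x \<in> {..<\<sigma>}. P x}" for P
    using distinct_card[of "filter P cs"] by (simp add: cs_def)
  then have net: "net_freq T S = length (filter X cs) + length (filter Y cs)"
    if "2 \<le> freq T S"
    using net_freq_characters[OF T that] by (simp add: X_def Y_def)
  have net0: "net_freq T S = 0" if "\<not> 2 \<le> freq T S" using that by (simp add: net_freq_eq)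
  have len: "text_len D = length T" using rep by (simp add: represents_via_def)
  have left: "runs_within D S (count (left_test cs) cs) s' (\<sigma> * b + 1)
      (\<lambda>s''. s'' 0 = s' 0 + length (filter X cs))" if "T \<noteq> []" for s'
  proof -
    have "runs_within D S (left_test cs x) s'' (200 * m + (10 + \<sigma> * (400 * m + 30)))
        (\<lambda>s'. s' 1 = of_bool (X x) \<and> s' 0 = s'' 0)" for x s''
      using runs_within_left_test[OF that, of S cs x s''] by (simp add: X_def m_def cs)
    from runs_within_count[of cs, OF this] show ?thesis by (simp add: cs(1) b_def)
  qed
  have right: "runs_within D S (count (right_test cs) cs) s' (\<sigma> * b + 1)
      (\<lambda>s''. s'' 0 = s' 0 + length (filter Y cs))" if "T \<noteq> []" for s'
  proof -
    have "runs_within D S (right_test cs x) s'' (200 * m + (10 + \<sigma> * (400 * m + 30)))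
        (\<lambda>s'. s' 1 = of_bool (Y x) \<and> s' 0 = s'' 0)" for x s''
      using runs_within_right_test[OF that, of S cs x s''] by (simp add: Y_def m_def cs)
    from runs_within_count[of cs, OF this] show ?thesis by (simp add: cs(1) b_def)
  qed
  let ?rest = "If (Less (Lit 1) (Reg 2))
    (Seq (count (left_test cs) cs) (count (right_test cs) cs)) Skip"
  \<comment> \<open>The summands are the test for the empty text, the descent along
    \<open>S\<close>, the test for repetition and the two counts.\<close>
  have "runs_within D S (net_freq_prog cs) s (3 + (200 * m + (3 + ((\<sigma> * b + 1) + (\<sigma> * b + 1)))))
      (\<lambda>s'. s' 0 = net_freq T S)"
  proof (cases "T = []")
    case True
    then have "runs_within D S (net_freq_prog cs) s (test_cost (Less (Lit 0) (Op0 TextLen)) + 1)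
      (\<lambda>s'. s' 0 = net_freq T S)"
      unfolding net_freq_prog_def
      by (intro runs_within_If runs_within_loop_free) (use len s net_freq_Nil in auto)
    then show ?thesis by (rule runs_within_mono) auto
  next
    case False
    have rest: "runs_within D S ?rest s1 (test_cost (Less (Lit 1) (Reg 2)) +
        ((\<sigma> * b + 1) + (\<sigma> * b + 1))) (\<lambda>s'. s' 0 = net_freq T S)"
      if s1: "s1 2 = min 2 (freq T ([] @ S @ [])) \<and> s1 0 = s 0 \<and> s1 1 = s 1" for s1
    proof (rule runs_within_If)
      assume "holds D S s1 (Less (Lit 1) (Reg 2))"
      then have two: "2 \<le> freq T S" using s1 by simp
      show "runs_within D S (Seq (count (left_test cs) cs) (count (right_test cs) cs)) s1
          ((\<sigma> * b + 1) + (\<sigma> * b + 1)) (\<lambda>s'. s' 0 = net_freq T S)"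
      proof (rule runs_within_Seq[OF left[OF False]])
        fix s2 :: "nat \<Rightarrow> nat" assume "s2 0 = s1 0 + length (filter X cs)"
        then show "runs_within D S (count (right_test cs) cs) s2 (\<sigma> * b + 1)
            (\<lambda>s'. s' 0 = net_freq T S)"
          by (intro runs_within_mono[OF right[OF False]]) (use net[OF two] s s1 in auto)
      qed
    next
      assume "\<not> holds D S s1 (Less (Lit 1) (Reg 2))"
      then show "runs_within D S Skip s1 ((\<sigma> * b + 1) + (\<sigma> * b + 1)) (\<lambda>s'. s' 0 = net_freq T S)"
        using s1 s net0 by (intro runs_within_loop_free) auto
    qed
    have "runs_within D S (Seq (descend [] []) ?rest) s
        (200 * m + (test_cost (Less (Lit 1) (Reg 2)) + ((\<sigma> * b + 1) + (\<sigma> * b + 1))))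
        (\<lambda>s'. s' 0 = net_freq T S)"
      unfolding m_def
    proof (rule runs_within_Seq[OF runs_within_descend[OF False]], goal_cases)
      case (3 s1)
      then show ?case by (rule rest)
    qed simp_all
    then have "runs_within D S (net_freq_prog cs) s (test_cost (Less (Lit 0) (Op0 TextLen)) +
        (200 * m + (test_cost (Less (Lit 1) (Reg 2)) + ((\<sigma> * b + 1) + (\<sigma> * b + 1)))))
        (\<lambda>s'. s' 0 = net_freq T S)"
      unfolding net_freq_prog_def by (intro runs_within_If) (use False len in auto)
    then show ?thesis by (rule runs_within_mono) simp_all
  qed
  moreover have "3 + (200 * m + (3 + ((\<sigma> * b + 1) + (\<sigma> * b + 1)))) \<le>
    (2 * \<sigma> * (430 * \<sigma> + 220) + 220) * m"
  proof -
    \<comment> \<open>Since \<open>m\<close> is at least 1, additive constants can be charged to it: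
      200 and 20 give 220, while 400 and 30 give 430.\<close>
    have "1 \<le> m" by (simp add: m_def)
    then have "b \<le> (430 * \<sigma> + 220) * m" by (simp add: b_def algebra_simps add_mono mult_le_mono2)
    then have "2 * (\<sigma> * b) \<le> 2 * (\<sigma> * ((430 * \<sigma> + 220) * m))" by simp
    moreover have "3 + 3 + 2 + 200 * m \<le> 220 * m" using \<open>1 \<le> m\<close> by simp
    ultimately show ?thesis by (simp add: algebra_simps)
  qed
  ultimately show ?thesis unfolding cs_def m_def by (rule runs_within_mono)
qed

end

theorem theorem3:
  fixes \<sigma> :: nat
  shows "\<exists>p c. \<forall>T n D S.
           set T \<subseteq> {..<\<sigma>} \<and> n \<le> length T \<and> represents D (take n T) \<and> set S \<subseteq> {..<\<sigma>} \<longrightarrow>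
             computes_within p D S (net_freq (take n T) S) (c * max 1 (length S))"
proof (intro exI[of _ "net_freq_prog [0..<\<sigma>]"] exI[of _ "2 * \<sigma> * (430 * \<sigma> + 220) + 220"] allI impI,
    elim conjE)
  \<comment> \<open>Both witnesses depend on \<sigma> alone. The online setting is an arbitrary
    prefix \<open>take n T\<close>, treated as a text of its own over the same alphabet.\<close>
  fix T n D S
  assume T: "set T \<subseteq> {..<\<sigma>}" and "represents D (take n T)"
  then obtain N lab where "represents_via N lab D (take n T)" unfolding represents_def by blast
  then have tree: "stored_tree N lab D (take n T)" by (rule stored_tree.intro)
  have "set (take n T) \<subseteq> {..<\<sigma>}" by (rule subset_trans[OF set_take_subset T])
  from stored_tree.runs_within_net_freq_prog[OF tree this, of "\<lambda>_. 0" S]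
  show "computes_within (net_freq_prog [0..<\<sigma>]) D S (net_freq (take n T) S)
      ((2 * \<sigma> * (430 * \<sigma> + 220) + 220) * max 1 (length S))"
    unfolding runs_within_def computes_within_def by blast
qed

end
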